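(* Let $\rho_1,\rho_2,\rho_3$ be arbitrary qubit states, i.e. density matrices on $\mathbb C^2$, and let $\beta=F(\{1,2,3\})-F(\{1,2\})-F(\{1,3\})-F(\{2,3\})$. Then $$\beta\le\frac{3\sqrt3}{2}-2.$$ Equality holds precisely when the triple is a pure trine, up to unitary conjugation and permutation of the states.
   Context: For density matrices $\rho_1,\rho_2,\rho_3$ and nonempty $H\subseteq\{1,2,3\}$, the minimum unnormalized discrimination error is $F(H)=|H|-D(H)$, where $D(H)=\max\sum_{i\in H}\operatorname{Tr}(\rho_iM_i)$, the maximum over all POVMs $(M_i)_{i\in H}$ (i.e. $M_i\ge0$, $\sum_{i\in H}M_i=\mathbb I$). The pure trine is the triple of pure qubit states $\frac12(\mathbb I+\vec r_i\cdot\vec\sigma)$ ($\vec\sigma$ the vector of Pauli matrices) with Bloch vectors $\vec r_1=(1,0,0)$, $\vec r_2=(-1/2,\sqrt3/2,0)$, $\vec r_3=(-1/2,-\sqrt3/2,0)$. *)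

theory Defs
  imports "HOL-Analysis.Analysis"
begin

definition conj_transpose :: "complex^'n^'m \<Rightarrow> complex^'m^'n" where
  "conj_transpose A = map_matrix cnj (transpose A)"

definition pos_semidef :: "complex^'n^'n \<Rightarrow> bool" where
  "pos_semidef A \<longleftrightarrow> conj_transpose A = A \<and>
     (\<forall>v. 0 \<le> Re (\<Sum>k\<in>UNIV. cnj (v $ k) * (A *v v) $ k))"

definition density_matrix :: "complex^'n^'n \<Rightarrow> bool" where
  "density_matrix \<rho> \<longleftrightarrow> pos_semidef \<rho> \<and> trace \<rho> = 1"

definition unitary_matrix :: "complex^'n^'n \<Rightarrow> bool" where
  "unitary_matrix U \<longleftrightarrow> conj_transpose U ** U = mat 1 \<and> U ** conj_transpose U = mat 1"

text \<open>The values of \<open>M\<close> outside \<open>H\<close> are irrelevant.\<close>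

definition povm :: "'i set \<Rightarrow> ('i \<Rightarrow> complex^'n^'n) \<Rightarrow> bool" where
  "povm H M \<longleftrightarrow> (\<forall>i\<in>H. pos_semidef (M i)) \<and> (\<Sum>i\<in>H. M i) = mat 1"

text \<open>The trace of a product of two Hermitian matrices is real, so taking real parts
  loses nothing.\<close>

definition success :: "('i \<Rightarrow> complex^'n^'n) \<Rightarrow> 'i set \<Rightarrow> ('i \<Rightarrow> complex^'n^'n) \<Rightarrow> real" where
  "success \<rho> H M = (\<Sum>i\<in>H. Re (trace (\<rho> i ** M i)))"

text \<open>The supremum is a maximum for finite nonempty \<open>H\<close>: see \<open>max_success_attained\<close> and
  \<open>success_le_max_success\<close> below.\<close>

definition max_success :: "('i \<Rightarrow> complex^'n^'n) \<Rightarrow> 'i set \<Rightarrow> real" where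
  "max_success \<rho> H = (SUP M\<in>{M. povm H M}. success \<rho> H M)"

definition min_error :: "('i \<Rightarrow> complex^'n^'n) \<Rightarrow> 'i set \<Rightarrow> real" where
  "min_error \<rho> H = real (card H) - max_success \<rho> H"

definition beta :: "(nat \<Rightarrow> complex^'n^'n) \<Rightarrow> real" where
  "beta \<rho> = min_error \<rho> {1,2,3} - min_error \<rho> {1,2} - min_error \<rho> {1,3} - min_error \<rho> {2,3}"

definition pauli_x :: "complex^2^2" where
  "pauli_x = vector [vector [0, 1], vector [1, 0]]"

definition pauli_y :: "complex^2^2" where
  "pauli_y = vector [vector [0, - \<i>], vector [\<i>, 0]]"

definition pauli_z :: "complex^2^2" where
  "pauli_z = vector [vector [1, 0], vector [0, - 1]]"

definition bloch_state :: "real^3 \<Rightarrow> complex^2^2" where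
  "bloch_state r =
     (1/2) *\<^sub>R (mat 1 + (r $ 1) *\<^sub>R pauli_x + (r $ 2) *\<^sub>R pauli_y + (r $ 3) *\<^sub>R pauli_z)"

text \<open>Only the arguments 1, 2, 3 are meaningful.\<close>

definition trine_bloch :: "nat \<Rightarrow> real^3" where
  "trine_bloch i =
     (if i = 1 then vector [1, 0, 0]
      else if i = 2 then vector [- 1/2, sqrt 3 / 2, 0]
      else vector [- 1/2, - sqrt 3 / 2, 0])"

definition trine :: "nat \<Rightarrow> complex^2^2" where
  "trine i = bloch_state (trine_bloch i)"

definition is_trine_up_to_symmetry :: "(nat \<Rightarrow> complex^2^2) \<Rightarrow> bool" where
  "is_trine_up_to_symmetry \<rho> \<longleftrightarrow>
     (\<exists>U \<pi>. unitary_matrix U \<and> \<pi> permutes {1,2,3} \<and>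
        (\<forall>i\<in>{1,2,3}. \<rho> i = U ** trine (\<pi> i) ** conj_transpose U))"

subsection \<open>The maximum is attained\<close>

lemma quadratic_form_pair:
  fixes A :: "complex^'n^'n" and c :: complex
  assumes "k \<noteq> l"
  defines "v \<equiv> axis k 1 + axis l c"
  shows "(\<Sum>m\<in>UNIV. cnj (v $ m) * (A *v v) $ m) =
    A$k$k + c * A$k$l + cnj c * A$l$k + c * cnj c * A$l$l"
proof -
  have Av: "(A *v v) $ m = A$m$k + c * A$m$l" for m
    unfolding v_def
    by (simp add: matrix_vector_mult_def axis_def algebra_simps sum.distrib
        if_distrib[of "\<lambda>x. _ * x"] cong: if_cong)
  have "(\<Sum>m\<in>UNIV. cnj (v $ m) * (A *v v) $ m) =
      (\<Sum>m\<in>UNIV. (if m = k then (A *v v) $ m else 0) + (if m = l then cnj c * (A *v v) $ m else 0))"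
    using assms(1) by (intro sum.cong) (auto simp: v_def axis_def)
  also have "\<dots> = (A *v v) $ k + cnj c * (A *v v) $ l"
    by (simp add: sum.distrib)
  finally show ?thesis
    by (simp add: Av algebra_simps)
qed

lemma quadratic_form_axis:
  fixes A :: "complex^'n^'n"
  shows "(\<Sum>m\<in>UNIV. cnj (axis k 1 $ m) * (A *v axis k 1) $ m) = A$k$k"
proof -
  have "(\<Sum>m\<in>UNIV. cnj (axis k 1 $ m) * (A *v axis k 1) $ m) =
      (\<Sum>m\<in>UNIV. if m = k then A$m$k else 0)"
    by (intro sum.cong)
      (auto simp: axis_def matrix_vector_mult_def if_distrib[of "\<lambda>x. _ * x"] cong: if_cong)
  then show ?thesis by simp
qed

lemma pos_semidef_diag: "pos_semidef A \<Longrightarrow> 0 \<le> Re (A$k$k)"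
  unfolding pos_semidef_def by (metis quadratic_form_axis)

lemma pos_semidef_entry:
  assumes "pos_semidef A"
  shows "2 * cmod (A$k$l) \<le> Re (A$k$k) + Re (A$l$l)"
proof -
  have herm: "A$m$n = cnj (A$n$m)" for m n
  proof -
    have "conj_transpose A = A" using assms by (simp add: pos_semidef_def)
    then have "conj_transpose A $ m $ n = A$m$n" by simp
    then show ?thesis by (simp add: conj_transpose_def transpose_def)
  qed
  show ?thesis
  proof (cases "k = l")
    case True
    have "Im (A$k$k) = 0"
      using herm[of k k] by (simp add: complex_eq_iff)
    then have "cmod (A$k$k) = \<bar>Re (A$k$k)\<bar>"
      by (simp add: cmod_def)
    then show ?thesis
      using True pos_semidef_diag[OF assms, of k] by simp
  next
    case False
    show ?thesis
    proof (cases "A$k$l = 0")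
      case True
      then show ?thesis
        using pos_semidef_diag[OF assms, of k] pos_semidef_diag[OF assms, of l] by simp
    next
      case nz: False
      define a where "a = A$k$l"
      define c where "c = - cnj a / cmod a"
      have a: "cmod a \<noteq> 0" using nz by (simp add: a_def)
      have na: "cnj a * a = complex_of_real (cmod a) * complex_of_real (cmod a)"
        using complex_norm_square[of a] by (simp add: power2_eq_square mult.commute)
      have ca: "c * a = - cmod a"
      proof -
        have "c * a = - (cnj a * a) / cmod a" by (simp add: c_def)
        then show ?thesis using a by (simp add: na)
      qed
      have ca': "cnj c * cnj a = - cmod a"
        using arg_cong[OF ca, of cnj] by simp
      have cc: "c * cnj c = 1"
      proof -
        have "c * cnj c = (cnj a * a) / (cmod a * cmod a)" by (simp add: c_def)
        then show ?thesis using a by (simp add: na)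
      qed
      have "0 \<le> Re (A$k$k + c * A$k$l + cnj c * A$l$k + c * cnj c * A$l$l)"
        using assms unfolding pos_semidef_def quadratic_form_pair[OF False, symmetric] by blast
      also have "A$l$k = cnj a"
        using herm a_def by blast
      finally show ?thesis
        unfolding a_def[symmetric] ca ca' cc by simp
    qed
  qed
qed

lemma povm_entry_le_1:
  assumes "finite H" "povm H M" "i \<in> H"
  shows "cmod (M i $ k $ l) \<le> 1"
proof -
  have diag: "Re (M i $ m $ m) \<le> 1" for m
  proof -
    have "Re (M i $ m $ m) \<le> (\<Sum>i\<in>H. Re (M i $ m $ m))"
      using assms by (intro member_le_sum) (auto simp: povm_def pos_semidef_diag)
    also have "\<dots> = Re ((\<Sum>i\<in>H. M i) $ m $ m)" by simp
    also have "\<dots> = 1" using assms(2) by (simp add: povm_def mat_def)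
    finally show ?thesis .
  qed
  have "pos_semidef (M i)" using assms by (auto simp: povm_def)
  from pos_semidef_entry[OF this, of k l] diag[of k] diag[of l] show ?thesis by linarith
qed

lemma closed_pos_semidef: "closed {A :: complex^'n^'n. pos_semidef A}"
proof -
  have entry: "continuous_on UNIV (\<lambda>A :: complex^'n^'n. A$k$l)" for k l
    by (intro continuous_on_component continuous_on_id)
  have "{A :: complex^'n^'n. pos_semidef A} = {A. \<forall>k l. cnj (A$l$k) = A$k$l} \<inter>
      {A. \<forall>v. 0 \<le> Re (\<Sum>k\<in>UNIV. cnj (v$k) * (\<Sum>l\<in>UNIV. A$k$l * v$l))}"
    by (auto simp: pos_semidef_def conj_transpose_def transpose_def vec_eq_iff
        matrix_vector_mult_def)
  moreover have "closed {A :: complex^'n^'n. \<forall>k l. cnj (A$l$k) = A$k$l}"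
    by (intro closed_Collect_all closed_Collect_eq continuous_on_cnj entry)
  moreover have "closed {A :: complex^'n^'n.
      \<forall>v. 0 \<le> Re (\<Sum>k\<in>UNIV. cnj (v$k) * (\<Sum>l\<in>UNIV. A$k$l * v$l))}"
    by (intro closed_Collect_all closed_Collect_le continuous_on_const continuous_on_Re
        continuous_on_sum continuous_on_mult entry)
  ultimately show ?thesis by (simp add: closed_Int)
qed

lemma compact_PiE_UNIV:
  fixes K :: "'i \<Rightarrow> 'b::topological_space set"
  assumes "\<And>i. compact (K i)"
  shows "compact (Pi UNIV K)"
  using compactin_PiE[of "\<lambda>i. euclidean" UNIV K] assms
  by (simp add: euclidean_product_topology PiE_UNIV_domain)

lemma max_success_aux:
  fixes \<rho> :: "'i \<Rightarrow> complex^'n^'n"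
  assumes "finite H" "H \<noteq> {}"
  shows "\<exists>M. povm H M \<and> (\<forall>N. povm H N \<longrightarrow> success \<rho> H N \<le> success \<rho> H M)"
proof -
  define B :: "(complex^'n^'n) set" where "B = {A. \<forall>k l. cmod (A$k$l) \<le> 1}"
  have "norm A \<le> (\<Sum>k\<in>(UNIV::'n set). \<Sum>l\<in>(UNIV::'n set). 1)" if "A \<in> B" for A
  proof -
    have "norm A \<le> (\<Sum>k\<in>UNIV. norm (A$k))"
      unfolding norm_vec_def[of A] by (rule L2_set_le_sum) simp
    also have "\<dots> \<le> (\<Sum>k\<in>UNIV. \<Sum>l\<in>UNIV. norm (A$k$l))"
      by (intro sum_mono) (simp add: norm_vec_def L2_set_le_sum)
    also have "\<dots> \<le> (\<Sum>k\<in>(UNIV::'n set). \<Sum>l\<in>(UNIV::'n set). 1)"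
      using that unfolding B_def by (intro sum_mono) auto
    finally show ?thesis .
  qed
  then have "bounded B" by (auto simp: bounded_iff)
  moreover have "closed B"
    unfolding B_def by (intro closed_Collect_all closed_Collect_le continuous_on_norm continuous_on_const
        continuous_on_component continuous_on_id)
  ultimately have B: "compact B" by (simp add: compact_eq_bounded_closed)
  define K where "K = (\<lambda>i. if i \<in> H then B \<inter> {A. pos_semidef A} else {0 :: complex^'n^'n})"
  define S where "S = Pi UNIV K \<inter> {M. (\<Sum>i\<in>H. M i) = mat 1}"
  have coord: "continuous_on X (\<lambda>M. M i)" for X :: "('i \<Rightarrow> complex^'n^'n) set" and i
    by (rule continuous_on_subset[OF continuous_on_product_coordinates subset_UNIV])
  have "compact (Pi UNIV K)"
    by (rule compact_PiE_UNIV) (simp add: K_def B closed_pos_semidef compact_Int_closed)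
  moreover have "closed {M. (\<Sum>i\<in>H. M i) = (mat 1 :: complex^'n^'n)}"
    by (rule closed_Collect_eq[OF continuous_on_sum[OF coord] continuous_on_const])
  ultimately have S: "compact S"
    unfolding S_def by (rule compact_Int_closed)
  have S_povm: "povm H M" if "M \<in> S" for M
    using that by (auto simp: S_def povm_def K_def Pi_iff split: if_splits)
  have povm_S: "(\<lambda>i. if i \<in> H then N i else 0) \<in> S" if "povm H N" for N
    using that povm_entry_le_1[OF assms(1) that]
    by (auto simp: S_def povm_def K_def B_def)
  obtain h where h: "h \<in> H" using assms by blast
  have "pos_semidef (mat 1 :: complex^'n^'n)"
  proof -
    have "conj_transpose (mat 1) = (mat 1 :: complex^'n^'n)"
      by (auto simp: conj_transpose_def vec_eq_iff mat_def transpose_def)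
    moreover have "0 \<le> Re (\<Sum>k\<in>UNIV. cnj (v $ k) * v $ k)" for v :: "complex^'n"
      by (simp add: sum_nonneg)
    ultimately show ?thesis
      unfolding pos_semidef_def matrix_vector_mul_lid by blast
  qed
  moreover have "pos_semidef (0 :: complex^'n^'n)"
    by (simp add: pos_semidef_def conj_transpose_def vec_eq_iff transpose_def)
  ultimately have "povm H (\<lambda>i. if i = h then mat 1 else 0 :: complex^'n^'n)"
    using assms h by (auto simp: povm_def)
  then have "S \<noteq> {}" using povm_S by blast
  moreover have "continuous_on S (success \<rho> H)"
    unfolding success_def trace_def matrix_matrix_mult_def vec_lambda_beta
    by (intro continuous_on_sum continuous_on_Re continuous_on_mult[OF continuous_on_const]
        continuous_on_component[OF continuous_on_component[OF coord]])
  ultimately obtain M where M: "M \<in> S" "\<And>N. N \<in> S \<Longrightarrow> success \<rho> H N \<le> success \<rho> H M"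
    using continuous_attains_sup[OF S] by blast
  have "success \<rho> H N \<le> success \<rho> H M" if "povm H N" for N
  proof -
    have "success \<rho> H N = success \<rho> H (\<lambda>i. if i \<in> H then N i else 0)"
      by (simp add: success_def)
    also have "\<dots> \<le> success \<rho> H M" using M povm_S that by blast
    finally show ?thesis .
  qed
  with M S_povm show ?thesis by blast
qed

lemma max_success_attained:
  assumes "finite H" "H \<noteq> {}"
  shows "\<exists>M. povm H M \<and> success \<rho> H M = max_success \<rho> H"
proof -
  obtain M where M: "povm H M" "\<forall>N. povm H N \<longrightarrow> success \<rho> H N \<le> success \<rho> H M"
    using max_success_aux[OF assms] by blast
  then have "max_success \<rho> H = success \<rho> H M"
    unfolding max_success_def by (intro cSup_eq_maximum) auto
  with M show ?thesis by auto
qed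

lemma success_le_max_success:
  assumes "finite H" "H \<noteq> {}" "povm H M"
  shows "success \<rho> H M \<le> max_success \<rho> H"
  using max_success_aux[OF assms(1,2), of \<rho>] assms(3) unfolding max_success_def
  by (intro cSUP_upper) (auto simp: bdd_above_def)

end

theory Submission
  imports Defs
begin

text \<open>Write \<open>\<rho>\<^sub>i = (1 + r\<^sub>i \<cdot> \<sigma>) / 2\<close> with \<open>|r\<^sub>i| \<le> 1\<close>. A POVM is a family
  \<open>m\<^sub>i 1 + w\<^sub>i \<cdot> \<sigma>\<close> with \<open>|w\<^sub>i| \<le> m\<^sub>i\<close>, \<open>\<Sum> m\<^sub>i = 1\<close>, \<open>\<Sum> w\<^sub>i = 0\<close>, and its success is \<open>1 + \<Sum> r\<^sub>i \<cdot> w\<^sub>i\<close>.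
  Hence \<open>D({i,j}) = 1 + |r\<^sub>i - r\<^sub>j| / 2\<close>, and with \<open>P\<close> the perimeter of the Bloch triangle
  \<open>\<beta> = P/2 - D({1,2,3})\<close>. Taking \<open>w\<^sub>i\<close> proportional to the vector from the centroid to \<open>r\<^sub>i\<close> gives
  \<open>D({1,2,3}) \<ge> 1 + sqrt S / 3\<close>, where \<open>S\<close> is the sum of the squared sides. As \<open>P \<le> sqrt (3 S)\<close> and
  \<open>S = 3 \<Sum> |r\<^sub>i|\<^sup>2 - |\<Sum> r\<^sub>i|\<^sup>2 \<le> 9\<close>, the bound follows; equality forces \<open>S = 9\<close> and equal sides, so
  unit vectors with sum zero and mutual distance \<open>sqrt 3\<close>. Conversely \<open>D({1,2,3}) \<le> 2\<close> always, and
  \<open>|r\<^sub>i - r\<^sub>j|\<^sup>2 = - 4 det (\<rho>\<^sub>i - \<rho>\<^sub>j)\<close> is invariant under unitary conjugation.\<close>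

section \<open>Hermitian matrices, states and POVMs in Pauli coordinates\<close>

definition pauli_comb :: "real \<Rightarrow> real^3 \<Rightarrow> complex^2^2" where
  "pauli_comb m w = m *\<^sub>R mat 1 + (w $ 1) *\<^sub>R pauli_x + (w $ 2) *\<^sub>R pauli_y + (w $ 3) *\<^sub>R pauli_z"

lemma pauli_comb_nth [simp]:
  "pauli_comb m w $ 1 $ 1 = Complex (m + w $ 3) 0"
  "pauli_comb m w $ 1 $ 2 = Complex (w $ 1) (- w $ 2)"
  "pauli_comb m w $ 2 $ 1 = Complex (w $ 1) (w $ 2)"
  "pauli_comb m w $ 2 $ 2 = Complex (m - w $ 3) 0"
  by (simp_all add: pauli_comb_def pauli_x_def pauli_y_def pauli_z_def mat_def complex_eq_iff)

lemma matrix_2_eqI: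
  fixes A B :: "'a^2^2"
  assumes "A $ 1 $ 1 = B $ 1 $ 1" "A $ 1 $ 2 = B $ 1 $ 2"
    "A $ 2 $ 1 = B $ 2 $ 1" "A $ 2 $ 2 = B $ 2 $ 2"
  shows "A = B"
  using assms by (simp add: vec_eq_iff forall_2)

lemma bloch_state_eq_pauli_comb: "bloch_state r = pauli_comb (1/2) (r /\<^sub>R 2)"
  by (simp add: bloch_state_def pauli_comb_def algebra_simps)

lemma hermitian_entries:
  assumes "conj_transpose A = A"
  shows "A $ k $ l = cnj (A $ l $ k)"
proof -
  have "conj_transpose A $ k $ l = A $ k $ l" using assms by simp
  then show ?thesis by (simp add: conj_transpose_def transpose_def)
qed

lemma hermitian_eq_pauli_comb:
  fixes A :: "complex^2^2"
  assumes "conj_transpose A = A"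
  obtains m w where "A = pauli_comb m w"
proof
  show "A = pauli_comb (Re (A$1$1 + A$2$2) / 2)
    (vector [Re (A$1$2), Im (A$2$1), Re (A$1$1 - A$2$2) / 2])"
    using hermitian_entries[OF assms, of 1 1] hermitian_entries[OF assms, of 2 2]
      hermitian_entries[OF assms, of 1 2]
    by (intro matrix_2_eqI) (auto simp: complex_eq_iff field_simps)
qed

lemma pauli_comb_hermitian: "conj_transpose (pauli_comb m w) = pauli_comb m w"
  by (intro matrix_2_eqI) (simp_all add: conj_transpose_def transpose_def complex_eq_iff)

lemma norm_real3_power2: "(norm (w :: real^3))\<^sup>2 = (w$1)\<^sup>2 + (w$2)\<^sup>2 + (w$3)\<^sup>2"
  unfolding power2_norm_eq_inner by (simp add: inner_vec_def sum_3 power2_eq_square)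

text \<open>The vector \<open>s\<close> is the unnormalized Bloch vector of \<open>v\<close>: the
  projector onto \<open>v\<close>, scaled by its squared norm, is
  \<open>pauli_comb (norm s / 2) (s /\<^sub>R 2)\<close>.\<close>

lemma pauli_comb_quadratic_form:
  fixes v :: "complex^2"
  defines "s \<equiv> vector [2 * Re (cnj (v$1) * v$2), 2 * Im (cnj (v$1) * v$2),
      (cmod (v$1))\<^sup>2 - (cmod (v$2))\<^sup>2] :: real^3"
  shows "Re (\<Sum>k\<in>UNIV. cnj (v $ k) * (pauli_comb m w *v v) $ k) =
      m * ((cmod (v$1))\<^sup>2 + (cmod (v$2))\<^sup>2) + w \<bullet> s"
    and "norm s = (cmod (v$1))\<^sup>2 + (cmod (v$2))\<^sup>2"
proof -
  show "Re (\<Sum>k\<in>UNIV. cnj (v $ k) * (pauli_comb m w *v v) $ k) =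
      m * ((cmod (v$1))\<^sup>2 + (cmod (v$2))\<^sup>2) + w \<bullet> s"
    unfolding s_def cmod_power2
    by (simp add: matrix_vector_mult_def sum_2 inner_vec_def sum_3 power2_eq_square algebra_simps)
  have "(norm s)\<^sup>2 = ((cmod (v$1))\<^sup>2 + (cmod (v$2))\<^sup>2)\<^sup>2"
    unfolding norm_real3_power2 s_def cmod_power2
    by (simp add: power2_eq_square algebra_simps)
  then show "norm s = (cmod (v$1))\<^sup>2 + (cmod (v$2))\<^sup>2"
    by (rule power2_eq_imp_eq) auto
qed

text \<open>The eigenvalues are \<open>m + norm w\<close> and \<open>m - norm w\<close>. Sufficiency
  is Cauchy-Schwarz on the quadratic form; necessity tests it on explicit vectors.\<close>

lemma pos_semidef_pauli_comb: "pos_semidef (pauli_comb m w) \<longleftrightarrow> norm w \<le> m"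
proof
  assume "norm w \<le> m"
  have "0 \<le> Re (\<Sum>k\<in>UNIV. cnj (v $ k) * (pauli_comb m w *v v) $ k)" for v
  proof -
    define s where "s = (vector [2 * Re (cnj (v$1) * v$2), 2 * Im (cnj (v$1) * v$2),
      (cmod (v$1))\<^sup>2 - (cmod (v$2))\<^sup>2] :: real^3)"
    have "- (w \<bullet> s) \<le> norm w * norm s"
      using Cauchy_Schwarz_ineq2[of w s] by linarith
    also have "\<dots> \<le> m * norm s"
      using \<open>norm w \<le> m\<close> by (intro mult_right_mono) auto
    finally show ?thesis
      unfolding pauli_comb_quadratic_form s_def by linarith
  qed
  then show "pos_semidef (pauli_comb m w)"
    by (simp add: pos_semidef_def pauli_comb_hermitian)
next
  assume psd: "pos_semidef (pauli_comb m w)"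
  have z: "\<bar>w$3\<bar> \<le> m"
    using pos_semidef_diag[OF psd, of 1] pos_semidef_diag[OF psd, of 2] by simp
  have q: "0 \<le> Re (\<Sum>k\<in>UNIV. cnj (v $ k) * (pauli_comb m w *v v) $ k)" for v
    using psd by (simp add: pos_semidef_def)
  \<comment> \<open>On the two columns of the adjugate the quadratic form is a diagonal entry times the
    determinant \<open>m\<^sup>2 - (norm w)\<^sup>2\<close>.\<close>
  have "0 \<le> (m + w$3) * (m\<^sup>2 - (norm w)\<^sup>2)"
    using q[of "vector [- Complex (w$1) (- w$2), Complex (m + w$3) 0]"]
    unfolding norm_real3_power2
    by (simp add: matrix_vector_mult_def sum_2 power2_eq_square algebra_simps)
  moreover have "0 \<le> (m - w$3) * (m\<^sup>2 - (norm w)\<^sup>2)"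
    using q[of "vector [Complex (m - w$3) 0, - Complex (w$1) (w$2)]"]
    unfolding norm_real3_power2
    by (simp add: matrix_vector_mult_def sum_2 power2_eq_square algebra_simps)
  ultimately have det: "0 \<le> m * (m\<^sup>2 - (norm w)\<^sup>2)"
    by (simp add: algebra_simps)
  \<comment> \<open>For \<open>m = 0\<close> the determinant inequality is empty; there the diagonal
    vanishes and dominates the off-diagonal entries.\<close>
  show "norm w \<le> m"
  proof (cases "m = 0")
    case True
    then have "Complex (w$1) (- w$2) = 0"
      using pos_semidef_entry[OF psd, of 1 2] by simp
    then have "w = 0"
      using z True by (simp add: vec_eq_iff forall_3 complex_eq_iff)
    then show ?thesis using True by simp
  next
    case False
    then have "0 < m" using z by linarith
    then have "(norm w)\<^sup>2 \<le> m\<^sup>2"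
      using det by (simp add: zero_le_mult_iff)
    then show ?thesis
      by (rule power2_le_imp_le) (use \<open>0 < m\<close> in simp)
  qed
qed

lemma density_matrix_bloch:
  assumes "density_matrix \<rho>"
  obtains r where "\<rho> = bloch_state r" "norm r \<le> 1"
proof -
  have psd: "pos_semidef \<rho>" and tr: "trace \<rho> = 1"
    using assms by (auto simp: density_matrix_def)
  obtain m w where \<rho>: "\<rho> = pauli_comb m w"
    using psd hermitian_eq_pauli_comb unfolding pos_semidef_def by blast
  have m: "m = 1/2"
    using tr by (simp add: \<rho> trace_def sum_2 complex_eq_iff)
  show ?thesis
  proof
    show "\<rho> = bloch_state (2 *\<^sub>R w)" by (simp add: bloch_state_eq_pauli_comb \<rho> m)
    show "norm (2 *\<^sub>R w) \<le> 1" using psd by (simp add: \<rho> pos_semidef_pauli_comb m)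
  qed
qed

lemma trace_bloch_state_pauli_comb:
  "Re (trace (bloch_state r ** pauli_comb m w)) = m + r \<bullet> w"
  by (simp add: bloch_state_eq_pauli_comb trace_def matrix_matrix_mult_def sum_2 sum_3
      inner_vec_def field_simps)

lemma sum_pauli_comb: "(\<Sum>i\<in>H. pauli_comb (m i) (w i)) = pauli_comb (sum m H) (sum w H)"
  by (intro matrix_2_eqI) (simp_all add: complex_eq_iff sum.distrib sum_subtractf sum_negf)

lemma pauli_comb_eq_mat_1: "pauli_comb m w = mat 1 \<longleftrightarrow> m = 1 \<and> w = 0"
proof
  assume *: "pauli_comb m w = mat 1"
  have "pauli_comb m w $ k $ l = mat 1 $ k $ l" for k l by (simp add: *)
  from this[of 1 1] this[of 1 2] this[of 2 2] show "m = 1 \<and> w = 0"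
    by (auto simp: mat_def vec_eq_iff forall_3 complex_eq_iff)
qed (simp add: pauli_comb_def)

lemma povm_pauli_comb:
  assumes "\<And>i. i \<in> H \<Longrightarrow> norm (w i) \<le> m i" "sum m H = 1" "sum w H = 0"
  shows "povm H (\<lambda>i. pauli_comb (m i) (w i))"
  using assms by (simp add: povm_def pos_semidef_pauli_comb sum_pauli_comb pauli_comb_eq_mat_1)

lemma povmE:
  fixes M :: "'i \<Rightarrow> complex^2^2"
  assumes "povm H M"
  obtains m w where "\<And>i. i \<in> H \<Longrightarrow> M i = pauli_comb (m i) (w i)"
    "\<And>i. i \<in> H \<Longrightarrow> norm (w i) \<le> m i" "sum m H = 1" "sum w H = 0"
proof -
  have "\<forall>i\<in>H. \<exists>m w. M i = pauli_comb m w"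
    using assms hermitian_eq_pauli_comb unfolding povm_def pos_semidef_def by metis
  then obtain m w where M: "\<And>i. i \<in> H \<Longrightarrow> M i = pauli_comb (m i) (w i)"
    by metis
  moreover have "norm (w i) \<le> m i" if "i \<in> H" for i
    using assms M[OF that] that by (metis povm_def pos_semidef_pauli_comb)
  moreover have "pauli_comb (sum m H) (sum w H) = mat 1"
    using assms M unfolding povm_def sum_pauli_comb[symmetric] by simp
  ultimately show ?thesis using that by (simp add: pauli_comb_eq_mat_1)
qed

section \<open>Optimal success in terms of Bloch vectors\<close>

context
  fixes \<rho> :: "'i \<Rightarrow> complex^2^2" and r :: "'i \<Rightarrow> real^3" and H :: "'i set"
  assumes bloch: "\<And>i. i \<in> H \<Longrightarrow> \<rho> i = bloch_state (r i)"
    and fin: "finite H" "H \<noteq> {}"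
begin

lemma success_pauli_comb:
  assumes "\<And>i. i \<in> H \<Longrightarrow> M i = pauli_comb (m i) (w i)" "sum m H = 1"
  shows "success \<rho> H M = 1 + (\<Sum>i\<in>H. r i \<bullet> w i)"
  using assms(2)
  by (simp add: success_def assms(1) bloch trace_bloch_state_pauli_comb sum.distrib cong: sum.cong)

text \<open>This and the next lemma eliminate the weights \<open>m i\<close>: the vectors
  \<open>w i\<close> extend to a POVM as soon as they sum to zero and their norms leave a
  nonnegative slack.\<close>

lemma max_success_bloch_ge:
  assumes "(\<Sum>i\<in>H. norm (w i)) \<le> 1" "sum w H = 0"
  shows "1 + (\<Sum>i\<in>H. r i \<bullet> w i) \<le> max_success \<rho> H"
proof -
  \<comment> \<open>The slack is spread evenly over \<open>H\<close>.\<close>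
  define m where "m i = norm (w i) + (1 - (\<Sum>i\<in>H. norm (w i))) / card H" for i
  have "sum m H = 1"
    using fin by (simp add: m_def sum.distrib)
  moreover have "norm (w i) \<le> m i" for i
    using assms(1) by (simp add: m_def)
  ultimately show ?thesis
    using success_le_max_success[OF fin povm_pauli_comb[of H w m], of \<rho>] assms(2)
      success_pauli_comb[of "\<lambda>i. pauli_comb (m i) (w i)" m w] by simp
qed

lemma max_success_bloch_le:
  assumes "\<And>w. (\<Sum>i\<in>H. norm (w i)) \<le> 1 \<Longrightarrow> sum w H = 0 \<Longrightarrow> (\<Sum>i\<in>H. r i \<bullet> w i) \<le> B"
  shows "max_success \<rho> H \<le> 1 + B"
proof -
  obtain M where M: "povm H M" "success \<rho> H M = max_success \<rho> H"
    using max_success_attained[OF fin] by blast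
  obtain m w where mw: "\<And>i. i \<in> H \<Longrightarrow> M i = pauli_comb (m i) (w i)"
      "\<And>i. i \<in> H \<Longrightarrow> norm (w i) \<le> m i" "sum m H = 1" "sum w H = 0"
    using povmE[OF M(1)] by blast
  have "(\<Sum>i\<in>H. norm (w i)) \<le> 1"
    using sum_mono[of H "\<lambda>i. norm (w i)" m] mw(2,3) by simp
  then show ?thesis
    using assms[of w] success_pauli_comb[OF mw(1,3)] mw(4) M(2) by simp
qed

end

text \<open>The Helstrom formula. Zero sum forces \<open>w j = - w i\<close>, so each norm is at
  most 1/2, and Cauchy-Schwarz is tight along \<open>r i - r j\<close>.\<close>

lemma max_success_pair:
  assumes "i \<noteq> j" "\<rho> i = bloch_state (r i)" "\<rho> j = bloch_state (r j)"
  shows "max_success \<rho> {i, j} = 1 + norm (r i - r j) / 2"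
proof (rule antisym)
  have bl: "\<rho> k = bloch_state (r k)" if "k \<in> {i, j}" for k
    using that assms by auto
  show "max_success \<rho> {i, j} \<le> 1 + norm (r i - r j) / 2"
  proof (rule max_success_bloch_le[OF bl])
    fix w :: "'a \<Rightarrow> real^3"
    assume "(\<Sum>k\<in>{i,j}. norm (w k)) \<le> 1" "sum w {i,j} = 0"
    then have s: "norm (w i) + norm (w j) \<le> 1" and w: "w j = - w i"
      using assms(1) by (auto simp: eq_neg_iff_add_eq_0 add.commute)
    then have half: "norm (w i) \<le> 1/2" by simp
    have "(\<Sum>k\<in>{i,j}. r k \<bullet> w k) = (r i - r j) \<bullet> w i"
      using assms(1) w by (simp add: inner_diff_left)
    also have "\<dots> \<le> norm (r i - r j) * norm (w i)"
      by (rule norm_cauchy_schwarz)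
    also have "\<dots> \<le> norm (r i - r j) * (1/2)"
      using half by (rule mult_left_mono) simp
    finally show "(\<Sum>k\<in>{i,j}. r k \<bullet> w k) \<le> norm (r i - r j) / 2" by simp
  qed auto
  \<comment> \<open>If the two states coincide, \<open>sgn\<close> gives 0 and the value is 1, as it
    should be.\<close>
  define u where "u = (1/2) *\<^sub>R sgn (r i - r j)"
  define w where "w k = (if k = i then u else - u)" for k
  have "norm u \<le> 1/2" by (simp add: u_def norm_sgn)
  then have "1 + (\<Sum>k\<in>{i,j}. r k \<bullet> w k) \<le> max_success \<rho> {i, j}"
    using assms(1) by (intro max_success_bloch_ge[OF bl]) (auto simp: w_def)
  moreover have "(\<Sum>k\<in>{i,j}. r k \<bullet> w k) = (r i - r j) \<bullet> u"
    using assms(1) by (simp add: w_def inner_diff_left)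
  moreover have "(r i - r j) \<bullet> u = norm (r i - r j) / 2"
    by (simp add: u_def sgn_div_norm divide_simps flip: power2_norm_eq_inner)
      (simp add: power2_eq_square)
  ultimately show "1 + norm (r i - r j) / 2 \<le> max_success \<rho> {i, j}" by simp
qed

text \<open>The constants cancel: 3 from the triple, -6 from the cardinalities of the pairs and +3
  from their success values.\<close>

lemma beta_bloch:
  assumes "\<And>i. i \<in> {1,2,3} \<Longrightarrow> \<rho> i = bloch_state (r i)"
  shows "beta \<rho> = (norm (r 1 - r 2) + norm (r 1 - r 3) + norm (r 2 - r 3)) / 2 -
    max_success \<rho> {1,2,3}"
  using assms by (simp add: beta_def min_error_def max_success_pair[where r = r] field_simps)

lemma max_success_bloch_le_2:
  assumes "\<And>i. i \<in> H \<Longrightarrow> \<rho> i = bloch_state (r i)" "finite H" "H \<noteq> {}"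
    and "\<And>i. i \<in> H \<Longrightarrow> norm (r i) \<le> 1"
  shows "max_success \<rho> H \<le> 2"
proof -
  have "max_success \<rho> H \<le> 1 + 1"
  proof (rule max_success_bloch_le[OF assms(1-3)])
    fix w :: "'a \<Rightarrow> real^3"
    assume w: "(\<Sum>i\<in>H. norm (w i)) \<le> 1"
    have "r i \<bullet> w i \<le> norm (w i)" if "i \<in> H" for i
      using norm_cauchy_schwarz[of "r i" "w i"]
        mult_right_mono[OF assms(4)[OF that], of "norm (w i)"] by simp
    then show "(\<Sum>i\<in>H. r i \<bullet> w i) \<le> 1"
      using w sum_mono[of H "\<lambda>i. r i \<bullet> w i" "\<lambda>i. norm (w i)"] by simp
  qed auto
  then show ?thesis by simp
qed

section \<open>Lower bound for three states\<close>

text \<open>The defect in Cauchy-Schwarz against (1,1,1). It bounds the centroid distances and the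
  perimeter, and detects equal sides.\<close>

lemma three_squares_diff:
  fixes a b c :: real
  shows "3 * (a\<^sup>2 + b\<^sup>2 + c\<^sup>2) - (a + b + c)\<^sup>2 = (a - b)\<^sup>2 + (a - c)\<^sup>2 + (b - c)\<^sup>2"
  by (simp add: power2_eq_square algebra_simps)

lemma sum_side_squares:
  fixes x y z :: "'a::real_inner"
  shows "(norm (x - y))\<^sup>2 + (norm (x - z))\<^sup>2 + (norm (y - z))\<^sup>2 =
    3 * ((norm x)\<^sup>2 + (norm y)\<^sup>2 + (norm z)\<^sup>2) - (norm (x + y + z))\<^sup>2"
  by (simp add: power2_norm_eq_inner inner_diff_left inner_diff_right inner_add_left
      inner_add_right inner_commute)

lemma max_success_triple_ge:
  assumes "\<And>i. i \<in> {1,2,3::nat} \<Longrightarrow> \<rho> i = bloch_state (r i)"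
  defines "S \<equiv> (norm (r 1 - r 2))\<^sup>2 + (norm (r 1 - r 3))\<^sup>2 + (norm (r 2 - r 3))\<^sup>2"
  shows "1 + sqrt S / 3 \<le> max_success \<rho> {1,2,3}"
proof -
  \<comment> \<open>The centroid \<open>g\<close>, the vectors \<open>d i\<close> from it, and the
    total length \<open>N\<close> that normalizes them.\<close>
  define g where "g = (1/3) *\<^sub>R (r 1 + r 2 + r 3)"
  define d where "d i = r i - g" for i
  define N where "N = norm (d 1) + norm (d 2) + norm (d 3)"
  have "g + g + g = (1/3 + 1/3 + 1/3) *\<^sub>R (r 1 + r 2 + r 3)"
    unfolding g_def scaleR_left_distrib ..
  then have "g + g + g = r 1 + r 2 + r 3" by simp
  then have d0: "d 1 + d 2 + d 3 = 0" by (simp add: d_def algebra_simps)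
  have S: "S = 3 * ((norm (d 1))\<^sup>2 + (norm (d 2))\<^sup>2 + (norm (d 3))\<^sup>2)"
    using sum_side_squares[of "d 1" "d 2" "d 3"] d0 by (simp add: S_def d_def)
  have "N\<^sup>2 \<le> S"
    using three_squares_diff[of "norm (d 1)" "norm (d 2)" "norm (d 3)"]
      sum_power2_ge_zero[of "norm (d 1) - norm (d 2)" "norm (d 1) - norm (d 3)"]
      zero_le_power2[of "norm (d 2) - norm (d 3)"]
    unfolding S N_def by linarith
  have N: "0 \<le> N" by (simp add: N_def)
  have S0: "0 \<le> S" by (simp add: S_def)
  have "S = 0" if "N = 0"
  proof -
    have "norm (d 1) = 0 \<and> norm (d 2) = 0 \<and> norm (d 3) = 0"
      using that norm_ge_zero[of "d 1"] norm_ge_zero[of "d 2"] norm_ge_zero[of "d 3"]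
      unfolding N_def by linarith
    then show ?thesis by (simp add: S)
  qed
  moreover have "sqrt S * N \<le> S"
  proof -
    have "N \<le> sqrt S" using \<open>N\<^sup>2 \<le> S\<close> by (rule real_le_rsqrt)
    then have "sqrt S * N \<le> sqrt S * sqrt S" using S0 by (intro mult_left_mono) auto
    also have "\<dots> = S" using S0 by simp
    finally show ?thesis .
  qed
  \<comment> \<open>For \<open>N = 0\<close> both sides are 0, by \<open>S = 0\<close> and division
    by zero.\<close>
  ultimately have "sqrt S \<le> S / N"
    using N by (cases "N = 0") (auto simp: field_simps)
  \<comment> \<open>The contribution of \<open>g\<close> vanishes because the \<open>d i\<close> sum
    to zero, which leaves the sum of their squared norms.\<close>
  have "r 1 \<bullet> d 1 + r 2 \<bullet> d 2 + r 3 \<bullet> d 3 = d 1 \<bullet> d 1 + d 2 \<bullet> d 2 + d 3 \<bullet> d 3 + g \<bullet> (d 1 + d 2 + d 3)"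
    unfolding inner_add_right by (simp add: d_def inner_diff_left)
  then have gain: "r 1 \<bullet> d 1 + r 2 \<bullet> d 2 + r 3 \<bullet> d 3 = S / 3"
    unfolding d0 S by (simp add: power2_norm_eq_inner)
  \<comment> \<open>When \<open>N = 0\<close> all the \<open>w i\<close> vanish and the estimate degenerates to \<open>S = 0\<close>.\<close>
  define w where "w i = inverse N *\<^sub>R d i" for i
  have "1 + (\<Sum>i\<in>{1,2,3}. r i \<bullet> w i) \<le> max_success \<rho> {1,2,3}"
  proof (rule max_success_bloch_ge[OF assms(1)])
    have "(\<Sum>i\<in>{1,2,3}. norm (w i)) = inverse N * N"
      using N by (simp add: w_def) (simp add: N_def algebra_simps)
    also have "\<dots> \<le> 1" by (cases "N = 0") auto
    finally show "(\<Sum>i\<in>{1,2,3}. norm (w i)) \<le> 1" .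
    have "sum w {1,2,3} = inverse N *\<^sub>R (d 1 + d 2 + d 3)"
      by (simp add: w_def algebra_simps)
    then show "sum w {1,2,3} = 0" unfolding d0 by simp
  qed auto
  moreover have "(\<Sum>i\<in>{1,2,3}. r i \<bullet> w i) = inverse N * (r 1 \<bullet> d 1 + r 2 \<bullet> d 2 + r 3 \<bullet> d 3)"
    by (simp add: w_def algebra_simps)
  moreover have "inverse N * (S / 3) = S / N / 3"
    by (simp add: field_simps)
  ultimately have "1 + S / N / 3 \<le> max_success \<rho> {1,2,3}"
    by (simp only: gain)
  moreover have "1 + sqrt S / 3 \<le> 1 + S / N / 3"
    using \<open>sqrt S \<le> S / N\<close> by simp
  ultimately show ?thesis by (rule order_trans[rotated])
qed

section \<open>Bloch distances as unitary invariants\<close>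

text \<open>The difference is traceless with eigenvalues plus and minus
  \<open>norm (r - s) / 2\<close>.\<close>

lemma det_bloch_state_diff: "det (bloch_state r - bloch_state s) = - of_real ((norm (r - s))\<^sup>2 / 4)"
  unfolding norm_real3_power2
  by (simp add: det_2 bloch_state_eq_pauli_comb complex_eq_iff power2_eq_square field_simps)

lemma trine_distance:
  assumes "i \<in> {1,2,3}" "j \<in> {1,2,3}" "i \<noteq> j"
  shows "(norm (trine_bloch i - trine_bloch j))\<^sup>2 = 3"
  unfolding norm_real3_power2
  using assms by (auto simp: trine_bloch_def power2_eq_square field_simps)

lemma matrix_mult_add_right: "(A + B) ** C = A ** C + B ** (C :: 'a::semiring_1^'n^'m)"
  by (simp add: vec_eq_iff matrix_matrix_mult_def algebra_simps sum.distrib)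

lemma matrix_mult_diff_left: "A ** (B - C) = A ** B - A ** (C :: 'a::ring_1^'n^'m)"
  by (simp add: vec_eq_iff matrix_matrix_mult_def algebra_simps sum_subtractf)

lemma matrix_mult_diff_right: "(A - B) ** C = A ** C - B ** (C :: 'a::ring_1^'n^'m)"
  by (simp add: vec_eq_iff matrix_matrix_mult_def algebra_simps sum_subtractf)

text \<open>Conjugation preserves the determinant of a difference, and the permutation is harmless
  because all pairs of the trine are equally far apart.\<close>

lemma trine_up_to_symmetry_distance:
  assumes "is_trine_up_to_symmetry \<rho>" "\<And>i. i \<in> {1,2,3} \<Longrightarrow> \<rho> i = bloch_state (r i)"
    and "i \<in> {1,2,3}" "j \<in> {1,2,3}" "i \<noteq> j"
  shows "norm (r i - r j) = sqrt 3"
proof -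
  obtain U \<pi> where U: "unitary_matrix U" and \<pi>: "\<pi> permutes {1,2,3}"
    and \<rho>: "\<And>i. i \<in> {1,2,3} \<Longrightarrow> \<rho> i = U ** trine (\<pi> i) ** conj_transpose U"
    using assms(1) unfolding is_trine_up_to_symmetry_def by metis
  have "\<rho> i - \<rho> j = U ** (trine (\<pi> i) - trine (\<pi> j)) ** conj_transpose U"
    by (simp add: \<rho>[OF assms(3)] \<rho>[OF assms(4)] matrix_mult_diff_left matrix_mult_diff_right)
  then have "det (\<rho> i - \<rho> j) = det (trine (\<pi> i) - trine (\<pi> j)) * det (U ** conj_transpose U)"
    by (simp add: det_mul)
  then have "det (bloch_state (r i) - bloch_state (r j)) =
      det (bloch_state (trine_bloch (\<pi> i)) - bloch_state (trine_bloch (\<pi> j)))"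
    using U assms by (simp add: unitary_matrix_def trine_def)
  then have "(norm (r i - r j))\<^sup>2 = (norm (trine_bloch (\<pi> i) - trine_bloch (\<pi> j)))\<^sup>2"
    unfolding det_bloch_state_diff neg_equal_iff_equal of_real_eq_iff by simp
  also have "\<dots> = 3"
    using \<pi> assms(3-5) by (intro trine_distance) (simp_all only: permutes_in_image inj_eq[OF permutes_inj] not_False_eq_True simp_thms)
  finally show ?thesis by (metis real_sqrt_unique norm_ge_zero)
qed

section \<open>A unitary realizing a given orthonormal pair of Bloch vectors\<close>

lemma unitary_matrixI:
  fixes U :: "complex^'n^'n"
  assumes "conj_transpose U ** U = mat 1"
  shows "unitary_matrix U"
  using assms matrix_left_right_inverse unfolding unitary_matrix_def by blast

text \<open>The Pauli combinations \<open>X\<close>, \<open>E\<close> of orthonormal vectors are anticommuting involutions, so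
  \<open>(E - \<i> X)\<^sup>2 = 0\<close>. A unit vector \<open>u\<close> in the kernel of \<open>E - \<i> X\<close> and its image \<open>X u\<close> form an
  orthonormal basis in which \<open>X\<close> and \<open>E\<close> become \<open>pauli_x\<close> and \<open>pauli_y\<close>.\<close>

lemma pauli_comb_kernel:
  assumes "norm a = 1" "norm e = 1" "a \<bullet> e = 0"
  obtains u :: "complex^2" where "pauli_comb 0 e *v u = \<i> *s (pauli_comb 0 a *v u)"
    "(cmod (u$1))\<^sup>2 + (cmod (u$2))\<^sup>2 = 1"
proof -
  define A where "A = pauli_comb 0 e - (\<chi> k l. \<i> * pauli_comb 0 a $ k $ l)"
  have sq: "(a$1)\<^sup>2 + (a$2)\<^sup>2 + (a$3)\<^sup>2 = 1" "(e$1)\<^sup>2 + (e$2)\<^sup>2 + (e$3)\<^sup>2 = 1"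
    "a$1 * e$1 + a$2 * e$2 + a$3 * e$3 = 0"
    using assms norm_real3_power2[of a] norm_real3_power2[of e]
    by (simp_all add: inner_vec_def sum_3)
  \<comment> \<open>With \<open>w\<close> the complex vector \<open>e - \<i> a\<close>, this
    determinant is minus the bilinear square of \<open>w\<close>, whose real part is a difference of
    equal norms and whose imaginary part is a multiple of \<open>a \<bullet> e\<close>.\<close>
  then have "det A = 0"
    by (simp add: det_2 A_def complex_eq_iff power2_eq_square algebra_simps)
  then obtain v where v: "A *v v = 0" "v \<noteq> 0"
    using invertible_det_nz[of A] invertible_left_inverse[of A] matrix_left_invertible_ker[of A]
    by blast
  define n where "n = sqrt ((cmod (v$1))\<^sup>2 + (cmod (v$2))\<^sup>2)"
  have n2: "n\<^sup>2 = (cmod (v$1))\<^sup>2 + (cmod (v$2))\<^sup>2" by (simp add: n_def)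
  have "n \<noteq> 0"
    using v(2) by (simp add: n_def vec_eq_iff forall_2 sum_power2_eq_zero_iff)
  show ?thesis
  proof
    have "pauli_comb 0 e *v v = \<i> *s (pauli_comb 0 a *v v)"
      using v(1) by (simp add: A_def vec_eq_iff forall_2 matrix_vector_mult_def sum_2 algebra_simps)
    then show "pauli_comb 0 e *v (of_real (inverse n) *s v) =
        \<i> *s (pauli_comb 0 a *v (of_real (inverse n) *s v))"
      by (simp add: vec.scale mult.commute)
    show "(cmod ((of_real (inverse n) *s v)$1))\<^sup>2 + (cmod ((of_real (inverse n) *s v)$2))\<^sup>2 = 1"
      using \<open>n \<noteq> 0\<close> by (simp add: norm_mult norm_inverse power_mult_distrib power_inverse
          flip: distrib_left n2)
  qed
qed

text \<open>Equal unit vectors give an involution, orthogonal ones give anticommutation.\<close>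

lemma pauli_comb_anticommutator:
  "pauli_comb 0 e *v (pauli_comb 0 a *v u) + pauli_comb 0 a *v (pauli_comb 0 e *v u) =
    of_real (2 * (a \<bullet> e)) *s u"
  by (simp add: vec_eq_iff forall_2 matrix_vector_mult_def sum_2 complex_eq_iff
      inner_vec_def sum_3 algebra_simps)

definition cinner2 :: "complex^2 \<Rightarrow> complex^2 \<Rightarrow> complex" where
  "cinner2 v w = cnj (v$1) * w$1 + cnj (v$2) * w$2"

lemma cinner2_commute: "cinner2 v w = cnj (cinner2 w v)"
  by (simp add: cinner2_def mult.commute)

lemma cinner2_pauli_comb: "cinner2 v (pauli_comb m a *v w) = cinner2 (pauli_comb m a *v v) w"
  by (simp add: cinner2_def matrix_vector_mult_def sum_2 complex_eq_iff algebra_simps)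

text \<open>The trine lies in the plane of the first two Bloch coordinates, so intertwining
  \<open>pauli_x\<close> with \<open>X\<close> and \<open>pauli_y\<close> with \<open>E\<close>
  determines its image.\<close>

lemma pauli_pair_unitary:
  assumes "norm a = 1" "norm e = 1" "a \<bullet> e = 0"
  obtains U where "unitary_matrix U"
    "\<And>c s. U ** bloch_state (vector [c, s, 0]) ** conj_transpose U = bloch_state (c *\<^sub>R a + s *\<^sub>R e)"
proof -
  define X where "X = pauli_comb 0 a"
  define E where "E = pauli_comb 0 e"
  obtain u where Eu: "E *v u = \<i> *s (X *v u)"
    and u: "(cmod (u$1))\<^sup>2 + (cmod (u$2))\<^sup>2 = 1"
    unfolding E_def X_def by (rule pauli_comb_kernel[OF assms])
  define t where "t = X *v u"
  have Xt: "X *v t = u"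
    using pauli_comb_anticommutator[of a a u] assms(1)
    by (simp add: t_def X_def vec_eq_iff norm_eq_1)
  have Et: "E *v t = (- \<i>) *s u"
  proof -
    have "E *v t = - (X *v (E *v u))"
      using pauli_comb_anticommutator[of e a u] assms(3)
      by (simp add: t_def X_def E_def eq_neg_iff_add_eq_0)
    also have "\<dots> = (- \<i>) *s (X *v t)"
      by (simp add: Eu t_def vec.scale)
    finally show ?thesis by (simp add: Xt)
  qed
  \<comment> \<open>The columns are \<open>u\<close> and \<open>t\<close>. On them \<open>X\<close>
    acts as a swap, and \<open>E\<close> sends \<open>u\<close> to \<open>\<i> *s t\<close> and
    \<open>t\<close> to \<open>(- \<i>) *s u\<close>.\<close>
  define U :: "complex^2^2" where "U = (\<chi> k l. if l = 1 then u $ k else t $ k)"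
  have XU: "X ** U = U ** pauli_x"
    using Xt by (intro matrix_2_eqI)
      (simp_all add: U_def matrix_matrix_mult_def pauli_x_def sum_2 t_def matrix_vector_mult_def vec_eq_iff forall_2)
  have EU: "E ** U = U ** pauli_y"
    using Et Eu unfolding t_def[symmetric]
    by (intro matrix_2_eqI)
      (simp_all add: U_def matrix_matrix_mult_def pauli_y_def sum_2 matrix_vector_mult_def vec_eq_iff forall_2 mult.commute)
  have uu: "cinner2 u u = 1"
    using u unfolding cmod_power2 by (simp add: cinner2_def complex_eq_iff power2_eq_square)
  have tt: "cinner2 t t = 1"
    using cinner2_pauli_comb[of u 0 a t] Xt uu by (simp add: t_def X_def)
  \<comment> \<open>Both \<open>\<langle>u, X u\<rangle>\<close> and \<open>\<langle>u, E u\<rangle> = \<i> \<langle>u, X u\<rangle>\<close> are real.\<close>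
  have "cinner2 u t = cnj (cinner2 u t)"
    using cinner2_pauli_comb[of u 0 a u] cinner2_commute[of t u] by (simp add: t_def X_def)
  moreover have "cinner2 u (E *v u) = cnj (cinner2 u (E *v u))"
    using cinner2_pauli_comb[of u 0 e u] cinner2_commute[of "E *v u" u] by (simp add: E_def)
  moreover have "cinner2 u (E *v u) = \<i> * cinner2 u t"
    by (simp add: Eu t_def cinner2_def algebra_simps)
  ultimately have ut: "cinner2 u t = 0"
    by (simp add: complex_eq_iff)
  then have "cinner2 t u = 0"
    using cinner2_commute[of t u] by simp
  then have "conj_transpose U ** U = mat 1"
    using uu tt ut
    by (intro matrix_2_eqI)
      (simp_all add: U_def conj_transpose_def transpose_def matrix_matrix_mult_def sum_2 mat_def
        cinner2_def)
  then have U: "unitary_matrix U" by (rule unitary_matrixI)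
  show ?thesis
  proof
    fix c s :: real
    have "U ** bloch_state (vector [c, s, 0]) = (1/2) *\<^sub>R (U + c *\<^sub>R (X ** U) + s *\<^sub>R (E ** U))"
      unfolding XU EU
      by (simp add: bloch_state_def matrix_scalar_ac matrix_add_ldistrib scaleR_add_right
          flip: scalar_matrix_assoc)
    also have "\<dots> = ((1/2) *\<^sub>R (mat 1 + c *\<^sub>R X + s *\<^sub>R E)) ** U"
      by (simp add: matrix_mult_add_right flip: scalar_matrix_assoc)
    also have "(1/2) *\<^sub>R (mat 1 + c *\<^sub>R X + s *\<^sub>R E) = bloch_state (c *\<^sub>R a + s *\<^sub>R e)"
      by (simp add: X_def E_def bloch_state_def pauli_comb_def algebra_simps)
    finally show "U ** bloch_state (vector [c, s, 0]) ** conj_transpose U = bloch_state (c *\<^sub>R a + s *\<^sub>R e)"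
      using U by (simp add: unitary_matrix_def flip: matrix_mul_assoc)
  qed (rule U)
qed

text \<open>The frame of \<open>r 1\<close> and the normalized \<open>r 2 - r 3\<close> is
  orthonormal, since \<open>r 2\<close> and \<open>r 3\<close> are equidistant from
  \<open>r 1\<close>. In it the coordinates are those of the trine with its own labelling, so the
  identity permutation serves.\<close>

lemma is_trine_up_to_symmetryI:
  assumes "\<And>i. i \<in> {1,2,3} \<Longrightarrow> \<rho> i = bloch_state (r i)"
    and norms: "norm (r 1) = 1" "norm (r 2) = 1" "norm (r 3) = 1"
    and sum: "r 1 + r 2 + r 3 = 0"
    and sides: "norm (r 1 - r 2) = sqrt 3" "norm (r 1 - r 3) = sqrt 3" "norm (r 2 - r 3) = sqrt 3"
  shows "is_trine_up_to_symmetry \<rho>"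
proof -
  define e where "e = (1 / sqrt 3) *\<^sub>R (r 2 - r 3)"
  have "(norm (r 1 - r 2))\<^sup>2 = (norm (r 1 - r 3))\<^sup>2" unfolding sides ..
  then have "r 1 \<bullet> r 2 = r 1 \<bullet> r 3"
    using norms unfolding power2_norm_eq_inner by (simp add: inner_diff_left inner_diff_right inner_commute norm_eq_1)
  then have "r 1 \<bullet> e = 0" by (simp add: e_def inner_diff_right)
  moreover have "norm e = 1" by (simp add: e_def sides)
  ultimately obtain U where U: "unitary_matrix U"
    "\<And>c s. U ** bloch_state (vector [c, s, 0]) ** conj_transpose U = bloch_state (c *\<^sub>R r 1 + s *\<^sub>R e)"
    using pauli_pair_unitary norms(1) by metis
  have r1: "r 1 = - r 2 - r 3"
    using sum by (simp add: algebra_simps eq_neg_iff_add_eq_0)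
  have e: "(sqrt 3 / 2) *\<^sub>R e = (1/2) *\<^sub>R (r 2 - r 3)" by (simp add: e_def)
  \<comment> \<open>Each vector is the midpoint of \<open>r 2\<close> and \<open>r 3\<close>, which
    is minus half of \<open>r 1\<close>, plus or minus half their difference.\<close>
  have r: "r 2 = (- 1/2) *\<^sub>R r 1 + (sqrt 3 / 2) *\<^sub>R e" "r 3 = (- 1/2) *\<^sub>R r 1 + (- sqrt 3 / 2) *\<^sub>R e"
    unfolding minus_divide_left[symmetric] scaleR_minus_left e unfolding r1 by (simp_all add: vec_eq_iff field_simps)
  have "\<rho> i = U ** trine i ** conj_transpose U" if "i \<in> {1,2,3}" for i
    using that assms(1)[OF that] r by (auto simp: trine_def trine_bloch_def U(2))
  then show ?thesis
    unfolding is_trine_up_to_symmetry_def using U(1) permutes_id[of "{1,2,3}"] by (metis id_apply)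
qed

section \<open>The inequality and its equality case\<close>

theorem proposition6p1:
  fixes \<rho> :: "nat \<Rightarrow> complex^2^2"
  assumes "\<forall>i\<in>{1,2,3}. density_matrix (\<rho> i)"
  shows "beta \<rho> \<le> 3 * sqrt 3 / 2 - 2 \<and>
    (beta \<rho> = 3 * sqrt 3 / 2 - 2 \<longleftrightarrow> is_trine_up_to_symmetry \<rho>)"
proof -
  have "\<forall>i\<in>{1,2,3}. \<exists>r. \<rho> i = bloch_state r \<and> norm r \<le> 1"
    using assms density_matrix_bloch by metis
  then obtain r where bloch: "\<And>i. i \<in> {1,2,3} \<Longrightarrow> \<rho> i = bloch_state (r i)"
    and ball: "\<And>i. i \<in> {1,2,3} \<Longrightarrow> norm (r i) \<le> 1"
    by metis
  define a where "a = norm (r 1 - r 2)"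
  define b where "b = norm (r 1 - r 3)"
  define c where "c = norm (r 2 - r 3)"
  define S where "S = a\<^sup>2 + b\<^sup>2 + c\<^sup>2"
  define q where "q = sqrt S"
  have q: "0 \<le> q" "q\<^sup>2 = S" by (simp_all add: q_def S_def)
  define D where "D = max_success \<rho> {1,2,3}"
  have beta: "beta \<rho> = (a + b + c) / 2 - D"
    using beta_bloch[OF bloch] by (simp add: D_def a_def b_def c_def)
  have D_ge: "1 + q / 3 \<le> D"
    using max_success_triple_ge[OF bloch] by (simp add: D_def q_def S_def a_def b_def c_def)
  have three: "3 * S - (a + b + c)\<^sup>2 = (a - b)\<^sup>2 + (a - c)\<^sup>2 + (b - c)\<^sup>2"
    unfolding S_def by (rule three_squares_diff)
  have "(sqrt 3 * q)\<^sup>2 = 3 * S"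
    by (simp add: power_mult_distrib q(2))
  then have "(a + b + c)\<^sup>2 \<le> (sqrt 3 * q)\<^sup>2"
    using three zero_le_power2[of "a - b"] zero_le_power2[of "a - c"] zero_le_power2[of "b - c"]
    by linarith
  then have perim: "a + b + c \<le> sqrt 3 * q"
    by (rule power2_le_imp_le) (simp add: q(1))
  have "S = 3 * ((norm (r 1))\<^sup>2 + (norm (r 2))\<^sup>2 + (norm (r 3))\<^sup>2) - (norm (r 1 + r 2 + r 3))\<^sup>2"
    unfolding S_def a_def b_def c_def by (rule sum_side_squares)
  note S = this[unfolded distrib_left]
  have sq: "(norm (r 1))\<^sup>2 \<le> 1" "(norm (r 2))\<^sup>2 \<le> 1" "(norm (r 3))\<^sup>2 \<le> 1"
    using ball by (simp_all add: power_le_one)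
  have "S \<le> 9" using S sq zero_le_power2[of "norm (r 1 + r 2 + r 3)"] by linarith
  then have "q \<le> sqrt 9" unfolding q_def by (rule real_sqrt_le_mono)
  then have q3: "q \<le> 3" by simp
  have s3: "1 < sqrt (3::real)" by simp
  \<comment> \<open>Combining the bounds on perimeter and success leaves a function affine in
    \<open>q\<close> with slope \<open>\<kappa>\<close>. The slope is positive, so the maximum is at
    \<open>q = 3\<close>.\<close>
  define \<kappa> where "\<kappa> = sqrt 3 / 2 - 1 / 3"
  have "0 < \<kappa>" unfolding \<kappa>_def using s3 by linarith
  have chain: "beta \<rho> \<le> \<kappa> * q - 1"
    using beta D_ge perim by (simp add: \<kappa>_def algebra_simps)
  have top: "\<kappa> * 3 - 1 = 3 * sqrt 3 / 2 - 2" by (simp add: \<kappa>_def)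
  have "\<kappa> * q \<le> \<kappa> * 3" using q3 \<open>0 < \<kappa>\<close> by simp
  then have bound: "beta \<rho> \<le> 3 * sqrt 3 / 2 - 2" using chain top by linarith
  have "is_trine_up_to_symmetry \<rho>" if eq: "beta \<rho> = 3 * sqrt 3 / 2 - 2"
  proof -
    have "\<kappa> * 3 \<le> \<kappa> * q" using chain top eq by linarith
    then have "q = 3" using q3 \<open>0 < \<kappa>\<close> by simp
    then have "S = 9" using q(2) by simp
    have "a + b + c = 3 * sqrt 3"
    proof (rule antisym)
      show "a + b + c \<le> 3 * sqrt 3" using perim \<open>q = 3\<close> by simp
      \<comment> \<open>At \<open>q = 3\<close> the success is at least 2, so the assumed value of
        \<open>beta\<close> bounds the perimeter from below.\<close>
      have "2 \<le> D" using D_ge \<open>q = 3\<close> by simp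
      then show "3 * sqrt 3 \<le> a + b + c" using beta eq by argo
    qed
    then have "(a + b + c)\<^sup>2 = 3 * S" by (simp add: \<open>S = 9\<close> power_mult_distrib)
    then have "(a - b)\<^sup>2 = 0" "(a - c)\<^sup>2 = 0"
      using three zero_le_power2[of "a - b"] zero_le_power2[of "a - c"] zero_le_power2[of "b - c"]
      by linarith+
    then have sides: "a = sqrt 3" "b = sqrt 3" "c = sqrt 3"
      using \<open>a + b + c = 3 * sqrt 3\<close> by simp_all
    \<comment> \<open>\<open>S = 9\<close> is possible only if each squared norm reaches 1 and the
      subtracted square vanishes.\<close>
    have "(norm (r 1))\<^sup>2 = 1" "(norm (r 2))\<^sup>2 = 1" "(norm (r 3))\<^sup>2 = 1"
        "(norm (r 1 + r 2 + r 3))\<^sup>2 = 0"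
      using S sq zero_le_power2[of "norm (r 1 + r 2 + r 3)"] \<open>S = 9\<close> by linarith+
    then have "norm (r 1) = 1" "norm (r 2) = 1" "norm (r 3) = 1" "r 1 + r 2 + r 3 = 0"
      by (simp_all only: abs_square_eq_1 abs_norm_cancel zero_eq_power2 norm_eq_zero)
    from is_trine_up_to_symmetryI[OF bloch this sides[unfolded a_def b_def c_def]]
    show ?thesis .
  qed
  moreover have "beta \<rho> = 3 * sqrt 3 / 2 - 2" if "is_trine_up_to_symmetry \<rho>"
  proof -
    have "a = sqrt 3" "b = sqrt 3" "c = sqrt 3"
      unfolding a_def b_def c_def by (rule trine_up_to_symmetry_distance[OF that bloch]; simp)+
    \<comment> \<open>With all sides \<open>sqrt 3\<close> this gives the reverse inequality for
      \<open>beta\<close>.\<close>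
    moreover have "D \<le> 2"
      unfolding D_def using bloch ball by (intro max_success_bloch_le_2[of _ \<rho> r]) auto
    ultimately show ?thesis using bound beta by argo
  qed
  ultimately show ?thesis using bound by blast
qed

end
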